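(* Let $(A_n)_{n\in\mathbb{N}}$ be a sequence of connected subsets of a metric space $X$ and let $A\subseteq X$ be such that $\lim_{n\to\infty}e(A,A_n)=0$. Then $$L^*(A)\leq\liminf_{n\to\infty}L^*(A_n).$$
   Context: Let $(X,d)$ be a metric space; conventions $\sup\emptyset=0$, $\inf\emptyset=\infty$. For $a\in X$ and $A,B\subseteq X$, $d(a,B)=\inf\{d(a,b): b\in B\}$, and the excess of $A$ over $B$ is $e(A,B)=\sup\{d(a,B): a\in A\}\in[0,\infty]$. Outer linear measure: for $A\subseteq X$, $\operatorname{diam}(A)=\sup\{d(a_1,a_2): a_1,a_2\in A\}$. A countable family $\{U_i: i\in\mathbb{N}\}$ of subsets of $X$ is a $\delta$-cover of $A$ if $\operatorname{diam}(U_i)\le\delta$ for all $i$ and $A\subseteq\bigcup_i U_i$. For $\delta>0$, $L^*_\delta(A)=\inf\{\sum_{i\in\mathbb{N}}\operatorname{diam}(U_i): \{U_i: i\in\mathbb{N}\}\text{ is a }\delta\text{-cover of }A\}$, and $L^*(A)=\sup_{\delta>0}L^*_\delta(A)=\lim_{\delta\to0}L^*_\delta(A)\in[0,\infty]$. *)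

theory Defs
  imports "HOL-Analysis.Analysis"
begin

text \<open>
  The quantities below take values in \<^typ>\<open>ennreal\<close>, where the supremum of the empty set is 0 and
  its infimum is \<open>\<infinity>\<close>. The library's \<^const>\<open>infdist\<close> and \<^const>\<open>diameter\<close> are real-valued, with
  other values at empty or unbounded sets, hence the extended versions here.
\<close>

definition einfdist :: "'a::metric_space \<Rightarrow> 'a set \<Rightarrow> ennreal" where
  "einfdist a B = (INF b\<in>B. ennreal (dist a b))"

definition excess :: "'a::metric_space set \<Rightarrow> 'a set \<Rightarrow> ennreal" where
  "excess A B = (SUP a\<in>A. einfdist a B)"

definition ediam :: "'a::metric_space set \<Rightarrow> ennreal" where
  "ediam A = (SUP a\<in>A. SUP b\<in>A. ennreal (dist a b))"

text \<open>A cover may contain empty sets, of diameter 0, so finite covers are included.\<close>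

definition delta_cover :: "real \<Rightarrow> 'a::metric_space set \<Rightarrow> (nat \<Rightarrow> 'a set) \<Rightarrow> bool" where
  "delta_cover \<delta> A U \<longleftrightarrow> (\<forall>i. ediam (U i) \<le> ennreal \<delta>) \<and> A \<subseteq> (\<Union>i. U i)"

definition linear_premeasure :: "real \<Rightarrow> 'a::metric_space set \<Rightarrow> ennreal" where
  "linear_premeasure \<delta> A = (INF U\<in>{U. delta_cover \<delta> A U}. \<Sum>i. ediam (U i))"

definition outer_linear_measure :: "'a::metric_space set \<Rightarrow> ennreal" where
  "outer_linear_measure A = (SUP \<delta>\<in>{0<..}. linear_premeasure \<delta> A)"

end

theory Submission
  imports Defs
begin

text \<open>
  Fix a scale \<open>h > 0\<close> and a number \<open>L\<close> above the limit inferior. The set \<open>A\<close> lies within a small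
  \<open>\<epsilon>\<close> of some \<open>C = An n\<close> of length below \<open>L\<close>. A cover of \<open>C\<close> turns into a cover of \<open>A\<close> when its
  members are thickened by \<open>\<epsilon>\<close>, but each member then costs \<open>2 * \<epsilon>\<close>, so this is harmless only if
  the number of members is bounded independently of \<open>n\<close>. For arbitrary sets there is no such
  bound; connectedness provides one (\<open>connected_pieces\<close>): up to an arbitrarily small error, a
  connected set of length below \<open>L\<close> is covered by at most \<open>L / h + 1\<close> pieces of diameter at most
  \<open>4 * h\<close> whose diameters sum to at most \<open>L\<close>. The error can be taken to be \<open>\<epsilon>\<close> too, so letting
  \<open>\<epsilon>\<close> tend to 0 with \<open>h\<close> and \<open>L\<close> fixed leaves the bound \<open>L\<close> for \<open>A\<close> at every scale.

  The pieces are found combinatorially. Cover \<open>C\<close> by open sets \<open>V i\<close> of diameter at most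
  \<open>w i \<le> h\<close> with \<open>\<Sum>i. w i \<le> L\<close>. Since \<open>C\<close> is connected, the sets meeting \<open>C\<close> are joined by
  chains of overlapping members of the cover (\<open>connected_open_cover_chain\<close>). Among the finite
  trees of overlapping members, choose one whose total weight is almost the supremum; any tree
  extending it has little additional weight, and therefore stays close to it
  (\<open>overlap_tree_extend\<close>). So a finite tree approximates all of \<open>C\<close>, although \<open>C\<close> need not be
  compact. A finite tree is cut from the leaves towards the root, severing a branch as soon as its
  depth exceeds \<open>h\<close> (\<open>overlap_tree_bundles\<close>). A severed branch is connected and deeper than \<open>h\<close>,
  so it uses up more than \<open>h\<close> of the total weight, which bounds the number of branches; and its
  diameter is at most its weight, which bounds the sum of the diameters.
\<close>

section \<open>Bounds on diameters\<close>

definition diam_at_most :: "'a::metric_space set \<Rightarrow> real \<Rightarrow> bool" where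
  "diam_at_most S c \<longleftrightarrow> (\<forall>x\<in>S. \<forall>y\<in>S. dist x y \<le> c)"

lemma ediam_le_iff:
  assumes "0 \<le> c"
  shows "ediam S \<le> ennreal c \<longleftrightarrow> diam_at_most S c"
  using assms by (auto simp: ediam_def diam_at_most_def SUP_le_iff ennreal_le_iff)

lemma diam_at_most_Un:
  assumes "diam_at_most S c" "diam_at_most T d" "S \<inter> T \<noteq> {}"
  shows "diam_at_most (S \<union> T) (c + d)"
proof -
  obtain z where z: "z \<in> S" "z \<in> T" using assms(3) by blast
  have cd: "0 \<le> c" "0 \<le> d"
    using assms z by (auto simp: diam_at_most_def dest!: bspec[where x=z])
  have ST: "dist x y \<le> c + d" if "x \<in> S" "y \<in> T" for x y
  proof -
    have "dist x y \<le> dist x z + dist z y" by (rule dist_triangle)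
    also have "\<dots> \<le> c + d"
      using assms z that by (intro add_mono) (auto simp: diam_at_most_def)
    finally show ?thesis .
  qed
  show ?thesis
    unfolding diam_at_most_def
  proof (intro ballI)
    fix x y assume "x \<in> S \<union> T" "y \<in> S \<union> T"
    then consider "x \<in> S" "y \<in> S" | "x \<in> T" "y \<in> T" | "x \<in> S" "y \<in> T" | "y \<in> S" "x \<in> T"
      by blast
    then show "dist x y \<le> c + d"
    proof cases
      case 1
      then have "dist x y \<le> c" using assms(1) by (simp add: diam_at_most_def)
      then show ?thesis using cd by simp
    next
      case 2
      then have "dist x y \<le> d" using assms(2) by (simp add: diam_at_most_def)
      then show ?thesis using cd by simp
    next
      case 3 then show ?thesis by (rule ST)
    next
      case 4 then show ?thesis using ST[of y x] by (simp add: dist_commute)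
    qed
  qed
qed

lemma diam_at_most_thickening:
  assumes "diam_at_most S c"
  shows "diam_at_most {x. \<exists>y\<in>S. dist x y \<le> r} (c + 2 * r)"
  unfolding diam_at_most_def
proof clarify
  fix x x' y y' assume *: "y \<in> S" "y' \<in> S" "dist x y \<le> r" "dist x' y' \<le> r"
  have "dist y y' \<le> c" using assms * by (simp add: diam_at_most_def)
  moreover have "dist x x' \<le> dist x y + dist y y' + dist y' x'"
    using dist_triangle[of x x' y] dist_triangle[of y x' y'] by linarith
  ultimately show "dist x x' \<le> c + 2 * r" using * by (simp add: dist_commute)
qed

lemma diam_at_most_mono: "diam_at_most T c \<Longrightarrow> S \<subseteq> T \<Longrightarrow> c \<le> d \<Longrightarrow> diam_at_most S d"
  unfolding diam_at_most_def by (meson order_trans subsetD)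

section \<open>Trees of overlapping sets\<close>

text \<open>
  Grafting a whole tree below the root, instead of attaching one leaf at a time, makes rule
  induction follow the branches from the leaves up to the root, as cutting off branches requires.
\<close>

inductive overlap_tree :: "('i \<Rightarrow> 'a set) \<Rightarrow> 'i \<Rightarrow> 'i set \<Rightarrow> bool" for V where
  single: "overlap_tree V r {r}"
| graft: "overlap_tree V r F \<Longrightarrow> overlap_tree V s G \<Longrightarrow> F \<inter> G = {} \<Longrightarrow> V r \<inter> V s \<noteq> {} \<Longrightarrow>
    overlap_tree V r (F \<union> G)"

lemma overlap_tree_finite: "overlap_tree V r F \<Longrightarrow> finite F"
  by (induction rule: overlap_tree.induct) auto

lemma overlap_tree_root: "overlap_tree V r F \<Longrightarrow> r \<in> F"
  by (induction rule: overlap_tree.induct) auto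

text \<open>
  Leaves can be attached anywhere: the attachment is passed down to the branch containing the
  vertex \<open>i\<close>. Hence every finite connected part of the overlap graph is spanned by a tree.
\<close>

lemma overlap_tree_insert:
  assumes "overlap_tree V r F" "i \<in> F" "j \<notin> F" "V i \<inter> V j \<noteq> {}"
  shows "overlap_tree V r (insert j F)"
  using assms
proof (induction arbitrary: i rule: overlap_tree.induct)
  case (single r)
  then have "overlap_tree V r ({r} \<union> {j})"
    by (intro overlap_tree.graft[OF overlap_tree.single overlap_tree.single]) auto
  then show ?case by (simp add: insert_commute)
next
  case (graft r F s G)
  show ?case
  proof (cases "i \<in> F")
    case True
    then have "overlap_tree V r (insert j F \<union> G)"
      using graft by (intro overlap_tree.graft[of V r _ s]) auto
    then show ?thesis by simp
  next
    case False
    then have "overlap_tree V r (F \<union> insert j G)"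
      using graft by (intro overlap_tree.graft[of V r _ s]) auto
    then show ?thesis by simp
  qed
qed

text \<open>
  Walking along a path to \<open>j\<close> and attaching each vertex that is still missing, every new set
  overlaps an earlier one, so it moves away from \<open>F\<close> by at most its own weight.
\<close>

lemma overlap_tree_extend:
  fixes w :: "'i \<Rightarrow> real"
  assumes tree: "overlap_tree V r F"
    and w: "\<And>i. 0 \<le> w i" "\<And>i. diam_at_most (V i) (w i)"
    and path: "(\<lambda>i j. V i \<inter> V j \<noteq> {})\<^sup>*\<^sup>* r j"
  shows "\<exists>F'. overlap_tree V r F' \<and> F \<subseteq> F' \<and> j \<in> F' \<and>
    (\<forall>x\<in>\<Union>(V ` F'). \<exists>y\<in>\<Union>(V ` F). dist x y \<le> sum w F' - sum w F)"
  using path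
proof (induction rule: rtranclp_induct)
  case base
  show ?case
    by (rule exI[of _ F]) (use tree overlap_tree_root in force)
next
  case (step i j)
  then obtain F' where F': "overlap_tree V r F'" "F \<subseteq> F'" "i \<in> F'"
    and near: "\<And>x. x \<in> \<Union>(V ` F') \<Longrightarrow> \<exists>y\<in>\<Union>(V ` F). dist x y \<le> sum w F' - sum w F"
    by blast
  show ?case
  proof (cases "j \<in> F'")
    case True
    then show ?thesis using F' near by blast
  next
    case False
    have sum: "sum w (insert j F') = w j + sum w F'"
      using False overlap_tree_finite[OF F'(1)] by simp
    obtain z where z: "z \<in> V i" "z \<in> V j" using step by blast
    obtain y where y: "y \<in> \<Union>(V ` F)" "dist z y \<le> sum w F' - sum w F"
      using near[of z] z F' by blast
    have "\<exists>y\<in>\<Union>(V ` F). dist x y \<le> sum w (insert j F') - sum w F"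
      if x: "x \<in> \<Union>(V ` insert j F')" for x
    proof (cases "x \<in> V j")
      case True
      have "dist x z \<le> w j" using w(2)[of j] True z by (simp add: diam_at_most_def)
      then have "dist x y \<le> sum w (insert j F') - sum w F"
        using dist_triangle[of x y z] y sum by linarith
      then show ?thesis using y by blast
    next
      case False
      then obtain y' where "y' \<in> \<Union>(V ` F)" "dist x y' \<le> sum w F' - sum w F"
        using near[of x] x by blast
      then show ?thesis using w(1)[of j] sum by (intro bexI[of _ y']) auto
    qed
    moreover have "overlap_tree V r (insert j F')"
      using overlap_tree_insert[OF F'(1,3) False] step by blast
    ultimately show ?thesis using F' by (intro exI[of _ "insert j F'"]) blast
  qed
qed

text \<open>
  Here \<open>Ps\<close> lists the branches severed so far, each with a bound on its diameter, and \<open>B\<close> is the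
  bundle of sets still attached to the root, of depth at most \<open>d\<close> as seen from \<open>V r\<close> and of
  weight \<open>c\<close>. When a second tree is grafted, its bundle \<open>B'\<close> is severed if its depth exceeds \<open>h\<close>;
  it then has weight above \<open>h\<close>, which pays for one more piece in the last inequality. Otherwise
  it is merged into \<open>B\<close>, and its points have depth at most \<open>w r + h \<le> 2 * h\<close> below \<open>V r\<close>. Every
  bundle thus has depth at most \<open>2 * h\<close>, and diameter at most \<open>4 * h\<close> through a point of its root.
\<close>

lemma overlap_tree_bundles:
  fixes w :: "'i \<Rightarrow> real" and V :: "'i \<Rightarrow> 'a::metric_space set"
  assumes "overlap_tree V r F"
    and w: "\<And>i. 0 \<le> w i" "\<And>i. w i \<le> h" "\<And>i. diam_at_most (V i) (w i)"
  shows "\<exists>B c d Ps. V r \<subseteq> B \<and> \<Union>(V ` F) \<subseteq> B \<union> \<Union>(fst ` set Ps) \<and>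
    diam_at_most B c \<and> w r \<le> c \<and> d \<le> c \<and> d \<le> 2 * h \<and> (\<forall>x\<in>V r. \<forall>y\<in>B. dist x y \<le> d) \<and>
    (\<forall>(P, p)\<in>set Ps. 0 \<le> p \<and> diam_at_most P p \<and> diam_at_most P (4 * h)) \<and>
    c + sum_list (map snd Ps) \<le> sum w F \<and> c + real (length Ps) * h \<le> sum w F"
  using assms(1)
proof (induction rule: overlap_tree.induct)
  case (single r)
  have "w r \<le> 2 * h" using w(1,2)[of r] by linarith
  then show ?case
    using w(1,3)
    by (intro exI[of _ "V r"] exI[of _ "w r"] exI[of _ "[]"]) (auto simp: diam_at_most_def)
next
  case (graft r F s G)
  obtain B c d Ps where 1: "V r \<subseteq> B" "\<Union>(V ` F) \<subseteq> B \<union> \<Union>(fst ` set Ps)"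
    "diam_at_most B c" "w r \<le> c" "d \<le> c" "d \<le> 2 * h" "\<forall>x\<in>V r. \<forall>y\<in>B. dist x y \<le> d"
    "\<forall>(P, p)\<in>set Ps. 0 \<le> p \<and> diam_at_most P p \<and> diam_at_most P (4 * h)"
    "c + sum_list (map snd Ps) \<le> sum w F" "c + real (length Ps) * h \<le> sum w F"
    using graft.IH(1) by blast
  obtain B' c' d' Ps' where 2: "V s \<subseteq> B'" "\<Union>(V ` G) \<subseteq> B' \<union> \<Union>(fst ` set Ps')"
    "diam_at_most B' c'" "w s \<le> c'" "d' \<le> c'" "d' \<le> 2 * h" "\<forall>x\<in>V s. \<forall>y\<in>B'. dist x y \<le> d'"
    "\<forall>(P, p)\<in>set Ps'. 0 \<le> p \<and> diam_at_most P p \<and> diam_at_most P (4 * h)"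
    "c' + sum_list (map snd Ps') \<le> sum w G" "c' + real (length Ps') * h \<le> sum w G"
    using graft.IH(2) by blast
  have sum: "sum w (F \<union> G) = sum w F + sum w G"
    using graft.hyps by (simp add: sum.union_disjoint overlap_tree_finite)
  obtain z where z: "z \<in> V r" "z \<in> V s" using graft.hyps(4) by blast
  show ?case
  proof (cases "h < d'")
    case True
    \<comment> \<open>The overlap of the two roots supplies the point of \<open>V s\<close> through which to measure.\<close>
    have "diam_at_most B' (4 * h)"
      unfolding diam_at_most_def
    proof (intro ballI)
      fix x y assume "x \<in> B'" "y \<in> B'"
      then have "dist z x \<le> d'" "dist z y \<le> d'" using 2(7) z by auto
      then show "dist x y \<le> 4 * h" using dist_triangle3[of x y z] 2(6) by linarith
    qed
    moreover have "0 \<le> c'" using 2(4) w(1)[of s] by linarith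
    moreover have "c + real (length ((B', c') # Ps @ Ps')) * h \<le> sum w F + sum w G"
      using 1(10) 2(10) 2(5) True by (simp add: algebra_simps)
    moreover have "c + sum_list (map snd ((B', c') # Ps @ Ps')) \<le> sum w F + sum w G"
      using 1(9) 2(9) by simp
    moreover have "\<Union>(V ` (F \<union> G)) \<subseteq> B \<union> \<Union>(fst ` set ((B', c') # Ps @ Ps'))"
      using 1(2) 2(2) by (simp add: image_Un) blast
    ultimately show ?thesis
      unfolding sum using 1 2(3,8)
      by (intro exI[of _ B] exI[of _ c] exI[of _ d] exI[of _ "(B', c') # Ps @ Ps'"]) auto
  next
    case False
    \<comment> \<open>The depth of the merged bundle: points of \<open>B'\<close> are reached by crossing \<open>V r\<close> first.\<close>
    define e where "e = max d (w r + d')"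
    have "diam_at_most (B \<union> B') (c + c')"
      using 1(1,3) 2(1,3) z by (intro diam_at_most_Un) auto
    moreover have c: "0 \<le> c'" using 2(4) w(1)[of s] by linarith
    moreover have "w r \<le> c + c'" "e \<le> c + c'" "e \<le> 2 * h"
      using 1(4-6) 2(5) c False w(2)[of r] by (auto simp: e_def)
    moreover have "\<forall>x\<in>V r. \<forall>y\<in>B \<union> B'. dist x y \<le> e"
    proof (intro ballI)
      fix x y assume x: "x \<in> V r" and y: "y \<in> B \<union> B'"
      show "dist x y \<le> e"
      proof (cases "y \<in> B")
        case True
        then have "dist x y \<le> d" using 1(7) x by blast
        then show ?thesis by (simp add: e_def)
      next
        case False
        then have "dist z y \<le> d'" using 2(7) z y by blast
        moreover have "dist x z \<le> w r" using w(3)[of r] x z by (simp add: diam_at_most_def)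
        ultimately show ?thesis using dist_triangle[of x y z] by (simp add: e_def)
      qed
    qed
    moreover have "c + c' + real (length (Ps @ Ps')) * h \<le> sum w F + sum w G"
      using 1(10) 2(10) by (simp add: algebra_simps)
    moreover have "c + c' + sum_list (map snd (Ps @ Ps')) \<le> sum w F + sum w G"
      using 1(9) 2(9) by simp
    moreover have "\<Union>(V ` (F \<union> G)) \<subseteq> (B \<union> B') \<union> \<Union>(fst ` set (Ps @ Ps'))"
      using 1(2) 2(2) by (simp add: image_Un) blast
    ultimately show ?thesis
      unfolding sum using 1(1,8) 2(8)
      by (intro exI[of _ "B \<union> B'"] exI[of _ "c + c'"] exI[of _ e] exI[of _ "Ps @ Ps'"]) auto
  qed
qed

text \<open>
  The bundle left at the root may be shallow, so its weight need not pay for it; it accounts for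
  the additional \<open>h\<close> in the bound on the number of pieces.
\<close>

lemma overlap_tree_pieces:
  fixes w :: "'i \<Rightarrow> real" and V :: "'i \<Rightarrow> 'a::metric_space set"
  assumes "overlap_tree V r F" "V r \<noteq> {}"
    and w: "\<And>i. 0 \<le> w i" "\<And>i. w i \<le> h" "\<And>i. diam_at_most (V i) (w i)"
  obtains Ps where "\<Union>(V ` F) \<subseteq> \<Union>(fst ` set Ps)"
    "\<forall>(P, p)\<in>set Ps. 0 \<le> p \<and> diam_at_most P p \<and> diam_at_most P (4 * h)"
    "sum_list (map snd Ps) \<le> sum w F" "real (length Ps) * h \<le> sum w F + h"
proof -
  obtain B c d Ps where 1: "V r \<subseteq> B" "\<Union>(V ` F) \<subseteq> B \<union> \<Union>(fst ` set Ps)"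
    "diam_at_most B c" "w r \<le> c" "d \<le> c" "d \<le> 2 * h" "\<forall>x\<in>V r. \<forall>y\<in>B. dist x y \<le> d"
    "\<forall>(P, p)\<in>set Ps. 0 \<le> p \<and> diam_at_most P p \<and> diam_at_most P (4 * h)"
    "c + sum_list (map snd Ps) \<le> sum w F" "c + real (length Ps) * h \<le> sum w F"
    using overlap_tree_bundles[OF assms(1) w] by blast
  have c: "0 \<le> c" using 1(4) w(1)[of r] by linarith
  obtain z where z: "z \<in> V r" using assms(2) by blast
  have "diam_at_most B (4 * h)"
    unfolding diam_at_most_def
  proof (intro ballI)
    fix x y assume "x \<in> B" "y \<in> B"
    then have "dist z x \<le> d" "dist z y \<le> d" using 1(7) z by auto
    then show "dist x y \<le> 4 * h" using dist_triangle3[of x y z] 1(6) by linarith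
  qed
  then show thesis
    using 1 c by (intro that[of "(B, c) # Ps"]) (auto simp: algebra_simps)
qed

section \<open>Connected sets of finite length\<close>

text \<open>
  The strict inequality leaves room to thicken the members of an efficient cover to open sets, by
  radii that form a geometric series.
\<close>

lemma open_cover_of_small_length:
  fixes C :: "'a::metric_space set"
  assumes "outer_linear_measure C < ennreal L" "0 < h"
  obtains V :: "nat \<Rightarrow> 'a set" and w :: "nat \<Rightarrow> real" where
    "\<forall>i. open (V i)" "\<forall>i. 0 \<le> w i \<and> w i \<le> h \<and> diam_at_most (V i) (w i)"
    "C \<subseteq> (\<Union>i. V i)" "summable w" "suminf w \<le> L"
proof -
  have "linear_premeasure (h/2) C \<le> outer_linear_measure C"
    unfolding outer_linear_measure_def by (rule SUP_upper) (use assms in auto)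
  then have "linear_premeasure (h/2) C < ennreal L" using assms by simp
  then obtain U where U: "delta_cover (h/2) C U" "(\<Sum>i. ediam (U i)) < ennreal L"
    unfolding linear_premeasure_def by (auto simp: INF_less_iff)
  define u where "u i = enn2real (ediam (U i))" for i
  have small: "ediam (U i) \<le> ennreal (h/2)" for i using U by (simp add: delta_cover_def)
  have u: "ediam (U i) = ennreal (u i)" for i
    using small[of i] by (metis u_def ennreal_enn2real ennreal_less_top order.strict_trans1)
  have u0: "0 \<le> u i" for i by (simp add: u_def)
  have uh: "u i \<le> h/2" for i using small[of i] assms(2) by (simp add: u ennreal_le_iff)
  have summable: "summable u"
    using U(2) by (intro summable_suminf_not_top) (auto simp: u u0)
  have "ennreal (suminf u) < ennreal L"
    using U(2) by (simp add: u suminf_ennreal2 u0 summable)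
  then have less: "suminf u < L"
    using suminf_nonneg[OF summable u0] by (simp add: ennreal_less_iff)
  \<comment> \<open>Radii \<open>k / 2^i\<close> add \<open>4 * k\<close> to the sum of the diameters and at most \<open>2 * k\<close> to each diameter.\<close>
  define k where "k = min h (L - suminf u) / 8"
  have k: "0 < k" "8 * k \<le> h" "8 * k \<le> L - suminf u" using less assms(2) by (auto simp: k_def)
  define e where "e i = k * (1/2)^i" for i :: nat
  have e: "0 < e i" "e i \<le> k" for i
    using k by (auto simp: e_def mult_le_cancel_left1 power_le_one)
  have e_sums: "(\<lambda>i. 2 * e i) sums (2 * (k * 2))"
    unfolding e_def using geometric_sums[of "1/2::real"] by (intro sums_mult) simp
  define V where "V i = (\<Union>x\<in>U i. ball x (e i))" for i
  have "diam_at_most (V i) (u i + 2 * e i)" for i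
  proof -
    have "diam_at_most (U i) (u i)" using ediam_le_iff[OF u0, of "U i" i] by (simp add: u)
    from diam_at_most_thickening[OF this, of "e i"] show ?thesis
    proof (rule diam_at_most_mono)
      show "V i \<subseteq> {x. \<exists>y\<in>U i. dist x y \<le> e i}"
      proof (intro subsetI CollectI)
        fix x assume "x \<in> V i"
        then obtain y where "y \<in> U i" "dist y x < e i" by (auto simp: V_def)
        then show "\<exists>y\<in>U i. dist x y \<le> e i" by (intro bexI[of _ y]) (simp_all add: dist_commute)
      qed
    qed simp
  qed
  moreover have "C \<subseteq> (\<Union>i. V i)"
  proof
    fix x assume "x \<in> C"
    then obtain i where "x \<in> U i" using U(1) unfolding delta_cover_def by blast
    then have "x \<in> V i" using e(1)[of i] unfolding V_def by (intro UN_I[of x]) auto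
    then show "x \<in> (\<Union>i. V i)" by blast
  qed
  moreover have "summable (\<lambda>i. u i + 2 * e i)"
    using summable e_sums by (intro summable_add) (auto simp: sums_iff)
  moreover have "(\<Sum>i. u i + 2 * e i) \<le> L"
    using suminf_add[OF summable, of "\<lambda>i. 2 * e i"] e_sums k by (auto simp: sums_iff)
  moreover have "u i + 2 * e i \<le> h" "0 \<le> u i + 2 * e i" for i
    using uh[of i] u0[of i] e[of i] k by linarith+
  moreover have "open (V i)" for i by (auto simp: V_def)
  ultimately show thesis by (intro that[of V "\<lambda>i. u i + 2 * e i"]) simp_all
qed

text \<open>
  The union of the sets reachable from \<open>V r\<close> and the union of the other sets are disjoint open sets
  covering \<open>C\<close>, and the first meets \<open>C\<close>; so the second misses it.
\<close>

lemma connected_open_cover_chain: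
  assumes "connected C" "\<forall>i. open (V i)" "C \<subseteq> (\<Union>i. V i)" "x \<in> C" "x \<in> V r" "y \<in> C"
  obtains j where "y \<in> V j" "(\<lambda>i j. V i \<inter> V j \<noteq> {})\<^sup>*\<^sup>* r j"
proof -
  define R where "R = {j. (\<lambda>i j. V i \<inter> V j \<noteq> {})\<^sup>*\<^sup>* r j}"
  have step: "j \<in> R" if "i \<in> R" "V i \<inter> V j \<noteq> {}" for i j
    using that by (auto simp: R_def intro: rtranclp.rtrancl_into_rtrancl)
  have "r \<in> R" by (simp add: R_def)
  have "\<Union>(V ` R) \<inter> C = {} \<or> \<Union>(V ` (-R)) \<inter> C = {}"
  proof (rule connectedD[OF assms(1)])
    show "open (\<Union>(V ` R))" "open (\<Union>(V ` (-R)))" using assms(2) by auto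
    show "\<Union>(V ` R) \<inter> \<Union>(V ` (-R)) \<inter> C = {}" using step by blast
    show "C \<subseteq> \<Union>(V ` R) \<union> \<Union>(V ` (-R))" using assms(3) by blast
  qed
  then have "\<Union>(V ` (-R)) \<inter> C = {}" using \<open>r \<in> R\<close> assms(4,5) by blast
  then obtain j where "j \<in> R" "y \<in> V j" using assms(3,6) by blast
  then show thesis using that by (simp add: R_def)
qed

text \<open>
  The number of pieces depends only on \<open>L\<close> and \<open>h\<close>, not on \<open>C\<close> or on the precision \<open>\<eta>\<close> with which
  the pieces approximate \<open>C\<close>.
\<close>

lemma connected_pieces:
  fixes C :: "'a::metric_space set"
  assumes "connected C" "outer_linear_measure C < ennreal L" "0 < h" "0 < \<eta>"
  obtains Ps :: "('a set \<times> real) list" where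
    "\<forall>x\<in>C. \<exists>y\<in>\<Union>(fst ` set Ps). dist x y \<le> \<eta>"
    "\<forall>(P, p)\<in>set Ps. 0 \<le> p \<and> diam_at_most P p \<and> diam_at_most P (4 * h)"
    "sum_list (map snd Ps) \<le> L" "real (length Ps) * h \<le> L + h"
proof (cases "C = {}")
  case True
  have "0 \<le> L" using assms(2) by (metis ennreal_neg not_le not_less_zero less_imp_le)
  then show ?thesis using True assms(3) by (intro that[of "[]"]) auto
next
  case False
  obtain V :: "nat \<Rightarrow> 'a set" and w where V: "\<forall>i. open (V i)"
    and "\<forall>i. 0 \<le> w i \<and> w i \<le> h \<and> diam_at_most (V i) (w i)"
    and C: "C \<subseteq> (\<Union>i. V i)" and sum: "summable w" "suminf w \<le> L"
    using open_cover_of_small_length[OF assms(2,3)] by blast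
  then have w: "\<And>i. 0 \<le> w i" "\<And>i. w i \<le> h" "\<And>i. diam_at_most (V i) (w i)" by blast+
  obtain x0 r where x0: "x0 \<in> C" "x0 \<in> V r" using False C by blast
  have bound: "sum w F \<le> L" if "overlap_tree V r F" for F
    using sum_le_suminf[OF sum(1) overlap_tree_finite[OF that]] w(1) sum(2) by force
  \<comment> \<open>A tree \<open>F\<close> of almost maximal weight: extensions of \<open>F\<close> add less than \<open>\<eta>\<close>.\<close>
  define S where "S = sum w ` {F. overlap_tree V r F}"
  have S: "S \<noteq> {}" "bdd_above S"
    using overlap_tree.single[of V r] bound by (auto simp: S_def intro!: bdd_aboveI2)
  obtain F where F: "overlap_tree V r F" "Sup S - \<eta> < sum w F"
    using less_cSup_iff[OF S, of "Sup S - \<eta>"] assms(4) by (auto simp: S_def)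
  have near: "\<exists>y\<in>\<Union>(V ` F). dist x y \<le> \<eta>" if x: "x \<in> C" for x
  proof -
    obtain j where j: "x \<in> V j" "(\<lambda>i j. V i \<inter> V j \<noteq> {})\<^sup>*\<^sup>* r j"
      by (rule connected_open_cover_chain[OF assms(1) V C x0 x])
    obtain F' where F': "overlap_tree V r F'" "j \<in> F'"
      "\<forall>x\<in>\<Union>(V ` F'). \<exists>y\<in>\<Union>(V ` F). dist x y \<le> sum w F' - sum w F"
      using overlap_tree_extend[OF F(1) w(1,3) j(2)] by blast
    obtain y where y: "y \<in> \<Union>(V ` F)" "dist x y \<le> sum w F' - sum w F"
      using F' j(1) by blast
    have "sum w F' \<le> Sup S" using F'(1) S(2) by (auto simp: S_def intro: cSup_upper)
    then show ?thesis using y F(2) by (intro bexI[of _ y]) auto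
  qed
  have ne: "V r \<noteq> {}" using x0 by blast
  obtain Ps where Ps: "\<Union>(V ` F) \<subseteq> \<Union>(fst ` set Ps)"
    "\<forall>(P, p)\<in>set Ps. 0 \<le> p \<and> diam_at_most P p \<and> diam_at_most P (4 * h)"
    "sum_list (map snd Ps) \<le> sum w F" "real (length Ps) * h \<le> sum w F + h"
    using overlap_tree_pieces[OF F(1) ne w] by blast
  show ?thesis
  proof (rule that[of Ps])
    show "\<forall>x\<in>C. \<exists>y\<in>\<Union>(fst ` set Ps). dist x y \<le> \<eta>"
      using near Ps(1) by blast
    show "sum_list (map snd Ps) \<le> L" "real (length Ps) * h \<le> L + h"
      using Ps(3,4) bound[OF F(1)] by linarith+
  qed (rule Ps(2))
qed

section \<open>Semicontinuity\<close>

lemma linear_premeasure_le_sum_list: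
  fixes Q :: "('a::metric_space set \<times> real) list"
  assumes "A \<subseteq> \<Union>(fst ` set Q)" "0 \<le> \<delta>"
    "\<And>P p. (P, p) \<in> set Q \<Longrightarrow> 0 \<le> p \<and> diam_at_most P p \<and> diam_at_most P \<delta>"
  shows "linear_premeasure \<delta> A \<le> ennreal (sum_list (map snd Q))"
proof -
  define U where "U i = (if i < length Q then fst (Q ! i) else {})" for i
  have Q: "0 \<le> snd (Q ! i)" "diam_at_most (fst (Q ! i)) (snd (Q ! i))"
    "diam_at_most (fst (Q ! i)) \<delta>" if "i < length Q" for i
    using assms(3)[of "fst (Q ! i)" "snd (Q ! i)"] that by auto
  have "delta_cover \<delta> A U"
    unfolding delta_cover_def
  proof
    show "\<forall>i. ediam (U i) \<le> ennreal \<delta>"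
      using Q assms(2) by (auto simp: U_def ediam_le_iff) (simp add: diam_at_most_def)
    show "A \<subseteq> (\<Union>i. U i)"
    proof
      fix x assume "x \<in> A"
      then obtain q where "q \<in> set Q" "x \<in> fst q" using assms(1) by blast
      then obtain i where "i < length Q" "x \<in> fst (Q ! i)" by (auto simp: in_set_conv_nth)
      then show "x \<in> (\<Union>i. U i)" by (auto simp: U_def)
    qed
  qed
  then have "linear_premeasure \<delta> A \<le> (\<Sum>i. ediam (U i))"
    unfolding linear_premeasure_def by (intro INF_lower) auto
  also have "\<dots> = (\<Sum>i<length Q. ediam (U i))"
    by (rule suminf_finite) (auto simp: U_def ediam_def bot_ennreal)
  also have "\<dots> \<le> (\<Sum>i<length Q. ennreal (snd (Q ! i)))"
    using Q by (intro sum_mono) (auto simp: U_def ediam_le_iff)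
  also have "\<dots> = ennreal (\<Sum>i<length Q. snd (Q ! i))"
    using Q by (intro sum_ennreal) auto
  also have "(\<Sum>i<length Q. snd (Q ! i)) = sum_list (map snd Q)"
    by (simp add: sum_list_sum_nth atLeast0LessThan)
  finally show ?thesis .
qed

text \<open>
  Each piece is thickened by \<open>2 * \<epsilon>\<close>: one \<open>\<epsilon>\<close> to get from \<open>A\<close> to \<open>C\<close>, one from \<open>C\<close> to the pieces. This
  adds \<open>4 * \<epsilon>\<close> to the diameter of each of the at most \<open>L / h + 1\<close> pieces.
\<close>

lemma linear_premeasure_le_near_connected:
  fixes A C :: "'a::metric_space set"
  assumes C: "connected C" "outer_linear_measure C < ennreal L"
    and near: "excess A C < ennreal \<epsilon>" and pos: "0 < h" "0 < \<epsilon>"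
  shows "linear_premeasure (4 * h + 4 * \<epsilon>) A \<le> ennreal (L + 4 * \<epsilon> * (L / h + 1))"
proof -
  obtain Ps :: "('a set \<times> real) list" where
    Ps: "\<forall>x\<in>C. \<exists>y\<in>\<Union>(fst ` set Ps). dist x y \<le> \<epsilon>"
    "\<forall>(P, p)\<in>set Ps. 0 \<le> p \<and> diam_at_most P p \<and> diam_at_most P (4 * h)"
    "sum_list (map snd Ps) \<le> L" "real (length Ps) * h \<le> L + h"
    using connected_pieces[OF C pos] by blast
  define Q where "Q = map (\<lambda>(P, p). ({x. \<exists>y\<in>P. dist x y \<le> 2 * \<epsilon>}, p + 4 * \<epsilon>)) Ps"
  have "linear_premeasure (4 * h + 4 * \<epsilon>) A \<le> ennreal (sum_list (map snd Q))"
  proof (rule linear_premeasure_le_sum_list)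
    show "A \<subseteq> \<Union>(fst ` set Q)"
    proof
      fix x assume "x \<in> A"
      then have "einfdist x C < ennreal \<epsilon>"
        using near unfolding excess_def by (meson SUP_upper order.strict_trans1)
      then obtain b where b: "b \<in> C" "dist x b < \<epsilon>"
        by (auto simp: einfdist_def INF_less_iff ennreal_less_iff)
      obtain P p y where y: "(P, p) \<in> set Ps" "y \<in> P" "dist b y \<le> \<epsilon>"
        using Ps(1) b(1) by force
      have "dist x y \<le> 2 * \<epsilon>" using dist_triangle[of x y b] b y by linarith
      then show "x \<in> \<Union>(fst ` set Q)" using y by (force simp: Q_def)
    qed
    show "0 \<le> 4 * h + 4 * \<epsilon>" using pos by simp
    fix P' p' assume "(P', p') \<in> set Q"
    then obtain P p where P: "(P, p) \<in> set Ps" and P': "P' = {x. \<exists>y\<in>P. dist x y \<le> 2 * \<epsilon>}"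
      "p' = p + 4 * \<epsilon>"
      by (auto simp: Q_def)
    show "0 \<le> p' \<and> diam_at_most P' p' \<and> diam_at_most P' (4 * h + 4 * \<epsilon>)"
      using bspec[OF Ps(2) P] pos diam_at_most_thickening[of P p "2 * \<epsilon>"]
        diam_at_most_thickening[of P "4 * h" "2 * \<epsilon>"] by (simp add: P')
  qed
  also have "sum_list (map snd Q) = sum_list (map snd Ps) + 4 * \<epsilon> * length Ps"
    unfolding Q_def by (induction Ps) (auto simp: algebra_simps)
  also have "ennreal \<dots> \<le> ennreal (L + 4 * \<epsilon> * (L / h + 1))"
  proof (intro ennreal_leI add_mono mult_left_mono)
    show "real (length Ps) \<le> L / h + 1" using Ps(4) pos by (simp add: field_simps)
  qed (use Ps pos in auto)
  finally show ?thesis .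
qed

lemma linear_premeasure_antimono:
  assumes "\<delta> \<le> \<delta>'"
  shows "linear_premeasure \<delta>' A \<le> linear_premeasure \<delta> A"
proof -
  have "delta_cover \<delta>' A U" if "delta_cover \<delta> A U" for U
    using that ennreal_leI[OF assms] unfolding delta_cover_def by (meson order_trans)
  then show ?thesis unfolding linear_premeasure_def by (intro INF_superset_mono) auto
qed

theorem theorem1:
  fixes A :: "'a::metric_space set" and An :: "nat \<Rightarrow> 'a set"
  assumes "\<And>n. connected (An n)"
    and "(\<lambda>n. excess A (An n)) \<longlonglongrightarrow> 0"
  shows "outer_linear_measure A \<le> liminf (\<lambda>n. outer_linear_measure (An n))"
proof (rule dense_ge)
  fix l assume l: "liminf (\<lambda>n. outer_linear_measure (An n)) < l"
  show "outer_linear_measure A \<le> l"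
  proof (cases l)
    case top
    then show ?thesis by simp
  next
    case (real L)
    have often: "\<exists>\<^sub>F n in sequentially. outer_linear_measure (An n) < ennreal L"
    proof (rule ccontr)
      assume "\<not> ?thesis"
      then have "\<forall>\<^sub>F n in sequentially. l \<le> outer_linear_measure (An n)"
        by (simp add: frequently_def not_less real)
      then show False using Liminf_bounded l by (metis not_le)
    qed
    \<comment> \<open>The scale \<open>h = \<delta>/8\<close> gives pieces of diameter \<open>\<delta>/2\<close>, leaving \<open>\<delta>/2\<close> for the thickening. The
      index \<open>n\<close> depends on \<open>\<epsilon>\<close>, but no longer occurs in the bound.\<close>
    have step: "linear_premeasure \<delta> A \<le> ennreal (L + 4 * \<epsilon> * (L / (\<delta>/8) + 1))"
      if \<delta>: "0 < \<delta>" and \<epsilon>: "0 < \<epsilon>" "8 * \<epsilon> \<le> \<delta>" for \<delta> \<epsilon>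
    proof -
      have "\<forall>\<^sub>F n in sequentially. excess A (An n) < ennreal \<epsilon>"
        using order_tendstoD(2)[OF assms(2), of "ennreal \<epsilon>"] \<epsilon> by simp
      then obtain n where n: "outer_linear_measure (An n) < ennreal L" "excess A (An n) < ennreal \<epsilon>"
        using frequently_ex[OF frequently_eventually_frequently[OF often]] by blast
      have "linear_premeasure \<delta> A \<le> linear_premeasure (4 * (\<delta>/8) + 4 * \<epsilon>) A"
        by (rule linear_premeasure_antimono) (use \<epsilon> in simp)
      also have "\<dots> \<le> ennreal (L + 4 * \<epsilon> * (L / (\<delta>/8) + 1))"
        by (rule linear_premeasure_le_near_connected[OF assms(1) n]) (use \<delta> \<epsilon> in auto)
      finally show ?thesis .
    qed
    have "linear_premeasure \<delta> A \<le> ennreal L" if \<delta>: "0 < \<delta>" for \<delta>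
    proof (rule tendsto_lowerbound)
      have "((\<lambda>\<epsilon>. L + 4 * \<epsilon> * (L / (\<delta>/8) + 1)) \<longlongrightarrow> L + 4 * 0 * (L / (\<delta>/8) + 1)) (at_right 0)"
        by (intro tendsto_intros)
      then show "((\<lambda>\<epsilon>. ennreal (L + 4 * \<epsilon> * (L / (\<delta>/8) + 1))) \<longlongrightarrow> ennreal L) (at_right 0)"
        by (intro tendsto_ennrealI) simp
      have "\<forall>\<^sub>F \<epsilon> in at_right 0. \<epsilon> \<in> {0<..<\<delta>/8}"
        by (rule eventually_at_right_real) (use \<delta> in simp)
      then show "\<forall>\<^sub>F \<epsilon> in at_right 0.
          linear_premeasure \<delta> A \<le> ennreal (L + 4 * \<epsilon> * (L / (\<delta>/8) + 1))"
        by eventually_elim (use step \<delta> in auto)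
    qed simp
    then show ?thesis
      unfolding outer_linear_measure_def real by (intro SUP_least) auto
  qed
qed

end
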